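(* For every real number $0<\delta<1$, every $c\in\mathbb N$ and every $\epsilon>0$ there exist a natural number $N$ and a XOR game $G$ with $N$ inputs per player such that $$\delta-\epsilon\le \omega(G)\le \delta+\epsilon\qquad\text{and}\qquad \delta-\epsilon\le \omega_c(G)\le\delta+\epsilon .$$
   Context: A XOR game $G=(f,\pi)$ with $N$ inputs per player consists of a function $f:[N]\times[N]\to\{-1,1\}$ and a probability distribution $\pi$ on $[N]\times[N]$; we identify it with the matrix $G_{x,y}=\pi(x,y)f(x,y)$. Alice receives $x$, Bob receives $y$, and each outputs a sign $a,b\in\{-1,1\}$. The value of a (possibly randomized) strategy is $\sum_{x,y}G_{x,y}\,\mathbb E[a\,b\mid x,y]$. The classical value is $\omega(G)=\sup\sum_{x,y}G_{x,y}\mathbb E_\lambda[\alpha(x,\lambda)\beta(y,\lambda)]$ over local strategies with shared randomness $\lambda$ and $\alpha,\beta$ taking values in $\{-1,1\}$; equivalently $\omega(G)=\max_{a,b\in\{-1,1\}^N}\sum_{x,y}G_{x,y}a_xb_y$. The value $\omega_c(G)$ is the supremum of the value over strategies in which Alice and Bob, using shared randomness, run a two-party communication protocol in which at most $c$ bits are exchanged in total, after which Alice outputs a sign depending on $x$, the transcript and the shared randomness, and Bob outputs a sign depending on $y$, the transcript and the shared randomness. *)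

theory Defs
  imports "HOL-Probability.Probability"
begin

definition is_xor_game :: "nat \<Rightarrow> (nat \<Rightarrow> nat \<Rightarrow> real) \<Rightarrow> bool" where
  "is_xor_game N G \<longleftrightarrow>
     (\<exists>(f :: nat \<Rightarrow> nat \<Rightarrow> real) (\<pi> :: (nat \<times> nat) pmf).
        (\<forall>x<N. \<forall>y<N. f x y \<in> {-1, 1}) \<and>
        set_pmf \<pi> \<subseteq> {..<N} \<times> {..<N} \<and>
        (\<forall>x<N. \<forall>y<N. G x y = pmf \<pi> (x, y) * f x y))"

definition xor_value ::
  "nat \<Rightarrow> (nat \<Rightarrow> nat \<Rightarrow> real) \<Rightarrow> 'r measure \<Rightarrow>
   ('r \<Rightarrow> nat \<Rightarrow> nat \<Rightarrow> real) \<Rightarrow> ('r \<Rightarrow> nat \<Rightarrow> nat \<Rightarrow> real) \<Rightarrow> real" where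
  "xor_value N G M a b =
     (\<Sum>x<N. \<Sum>y<N. G x y * (\<integral>r. a r x y * b r x y \<partial>M))"

definition local_strategy ::
  "nat \<Rightarrow> 'r measure \<Rightarrow> ('r \<Rightarrow> nat \<Rightarrow> real) \<Rightarrow> ('r \<Rightarrow> nat \<Rightarrow> real) \<Rightarrow> bool" where
  "local_strategy N M \<alpha> \<beta> \<longleftrightarrow>
     prob_space M \<and>
     (\<forall>x<N. (\<lambda>r. \<alpha> r x) \<in> borel_measurable M \<and> (\<forall>r\<in>space M. \<alpha> r x \<in> {-1, 1})) \<and>
     (\<forall>y<N. (\<lambda>r. \<beta> r y) \<in> borel_measurable M \<and> (\<forall>r\<in>space M. \<beta> r y \<in> {-1, 1}))"

text \<open>Both suprema below range over arbitrary probability spaces (with any sigma-algebra) whose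
  points are reals, since a supremum cannot range over all types. The lemmas
  \<open>xor_value_le_classical_value\<close> and \<open>xor_value_le_comm_value\<close> show that shared randomness of any
  other type gives nothing more.\<close>

definition classical_value :: "nat \<Rightarrow> (nat \<Rightarrow> nat \<Rightarrow> real) \<Rightarrow> real" where
  "classical_value N G =
     Sup {xor_value N G M (\<lambda>r x y. \<alpha> r x) (\<lambda>r x y. \<beta> r y) |
            (M :: real measure) \<alpha> \<beta>. local_strategy N M \<alpha> \<beta>}"

text \<open>A deterministic two-party protocol tree: each inner node fixes who sends the next bit, the
  bit as a function of the sender's input only, and how the protocol continues after that bit.
  A node thus encodes the transcript so far. Public-coin protocols are families of such trees
  indexed by the shared randomness.\<close>

datatype protocol =
    Stop
  | Alice "nat \<Rightarrow> bool" "bool \<Rightarrow> protocol"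
  | Bob "nat \<Rightarrow> bool" "bool \<Rightarrow> protocol"

primrec transcript :: "protocol \<Rightarrow> nat \<Rightarrow> nat \<Rightarrow> bool list" where
  "transcript Stop x y = []"
| "transcript (Alice m k) x y = m x # transcript (k (m x)) x y"
| "transcript (Bob m k) x y = m y # transcript (k (m y)) x y"

definition comm_strategy ::
  "nat \<Rightarrow> nat \<Rightarrow> 'r measure \<Rightarrow> ('r \<Rightarrow> protocol) \<Rightarrow>
   ('r \<Rightarrow> nat \<Rightarrow> bool list \<Rightarrow> real) \<Rightarrow> ('r \<Rightarrow> nat \<Rightarrow> bool list \<Rightarrow> real) \<Rightarrow> bool" where
  "comm_strategy c N M P \<alpha> \<beta> \<longleftrightarrow>
     prob_space M \<and>
     (\<forall>r\<in>space M. \<forall>x<N. \<forall>y<N. length (transcript (P r) x y) \<le> c) \<and>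
     (\<forall>r\<in>space M. \<forall>x<N. \<forall>t. \<alpha> r x t \<in> {-1, 1}) \<and>
     (\<forall>r\<in>space M. \<forall>y<N. \<forall>t. \<beta> r y t \<in> {-1, 1}) \<and>
     (\<forall>x<N. \<forall>y<N. (\<lambda>r. \<alpha> r x (transcript (P r) x y)) \<in> borel_measurable M \<and>
                  (\<lambda>r. \<beta> r y (transcript (P r) x y)) \<in> borel_measurable M)"

definition comm_value :: "nat \<Rightarrow> nat \<Rightarrow> (nat \<Rightarrow> nat \<Rightarrow> real) \<Rightarrow> real" where
  "comm_value c N G =
     Sup {xor_value N G M (\<lambda>r x y. \<alpha> r x (transcript (P r) x y))
                          (\<lambda>r x y. \<beta> r y (transcript (P r) x y)) |
            (M :: real measure) P \<alpha> \<beta>. comm_strategy c N M P \<alpha> \<beta>}"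

lemma xor_value_le_pointwise:
  fixes M :: "'r measure"
  assumes "prob_space M"
    and sa: "\<And>r x y. r \<in> space M \<Longrightarrow> x < N \<Longrightarrow> y < N \<Longrightarrow> a r x y \<in> {-1, 1}"
    and sb: "\<And>r x y. r \<in> space M \<Longrightarrow> x < N \<Longrightarrow> y < N \<Longrightarrow> b r x y \<in> {-1, 1}"
    and ma: "\<And>x y. x < N \<Longrightarrow> y < N \<Longrightarrow> (\<lambda>r. a r x y) \<in> borel_measurable M"
    and mb: "\<And>x y. x < N \<Longrightarrow> y < N \<Longrightarrow> (\<lambda>r. b r x y) \<in> borel_measurable M"
  obtains r where "r \<in> space M"
    "xor_value N G M a b \<le> (\<Sum>x<N. \<Sum>y<N. G x y * (a r x y * b r x y))"
proof -
  interpret prob_space M by fact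
  define h where "h r = (\<Sum>x<N. \<Sum>y<N. G x y * (a r x y * b r x y))" for r
  have int: "integrable M (\<lambda>r. a r x y * b r x y)" if "x < N" "y < N" for x y
  proof (rule integrable_const_bound[where B = 1])
    show "AE r in M. norm (a r x y * b r x y) \<le> 1"
      using sa[OF _ that] sb[OF _ that] by (intro AE_I2) (fastforce simp: abs_mult)
    show "(\<lambda>r. a r x y * b r x y) \<in> borel_measurable M"
      using ma[OF that] mb[OF that] by simp
  qed
  have inth: "integrable M h"
    unfolding h_def by (intro Bochner_Integration.integrable_sum integrable_mult_right int) auto
  have eq: "xor_value N G M a b = expectation h"
    unfolding xor_value_def h_def
    by (subst Bochner_Integration.integral_sum,
        (intro Bochner_Integration.integrable_sum integrable_mult_right int; simp),
        intro sum.cong refl, subst Bochner_Integration.integral_sum)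
       (auto intro!: int integrable_mult_right)
  have "\<exists>r\<in>space M. expectation h \<le> h r"
  proof (rule ccontr)
    assume "\<not> ?thesis"
    then have "AE r in M. h r < expectation h" by (intro AE_I2) auto
    then have "expectation h < expectation (\<lambda>_. expectation h)"
      using inth by (intro integral_less_AE_space) (auto simp: emeasure_space_1)
    then show False by (simp add: prob_space)
  qed
  with that show thesis unfolding eq h_def by blast
qed

lemma xor_value_le_sum_abs:
  fixes M :: "'r measure"
  assumes "prob_space M"
    and sa: "\<And>r x y. r \<in> space M \<Longrightarrow> x < N \<Longrightarrow> y < N \<Longrightarrow> a r x y \<in> {-1, 1}"
    and sb: "\<And>r x y. r \<in> space M \<Longrightarrow> x < N \<Longrightarrow> y < N \<Longrightarrow> b r x y \<in> {-1, 1}"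
    and ma: "\<And>x y. x < N \<Longrightarrow> y < N \<Longrightarrow> (\<lambda>r. a r x y) \<in> borel_measurable M"
    and mb: "\<And>x y. x < N \<Longrightarrow> y < N \<Longrightarrow> (\<lambda>r. b r x y) \<in> borel_measurable M"
  shows "xor_value N G M a b \<le> (\<Sum>x<N. \<Sum>y<N. \<bar>G x y\<bar>)"
proof -
  obtain r where r: "r \<in> space M"
    and le: "xor_value N G M a b \<le> (\<Sum>x<N. \<Sum>y<N. G x y * (a r x y * b r x y))"
    using assms by (rule xor_value_le_pointwise[where G = G])
  have "G x y * (a r x y * b r x y) \<le> \<bar>G x y\<bar>" if "x < N" "y < N" for x y
    using sa[OF r that] sb[OF r that] by auto
  then have "(\<Sum>x<N. \<Sum>y<N. G x y * (a r x y * b r x y)) \<le> (\<Sum>x<N. \<Sum>y<N. \<bar>G x y\<bar>)"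
    by (intro sum_mono) auto
  with le show ?thesis by linarith
qed

lemma xor_value_le_classical_value:
  fixes M :: "'r measure"
  assumes "local_strategy N M \<alpha> \<beta>"
  shows "xor_value N G M (\<lambda>r x y. \<alpha> r x) (\<lambda>r x y. \<beta> r y) \<le> classical_value N G"
proof -
  obtain r where r: "r \<in> space M" and le: "xor_value N G M (\<lambda>r x y. \<alpha> r x) (\<lambda>r x y. \<beta> r y)
      \<le> (\<Sum>x<N. \<Sum>y<N. G x y * (\<alpha> r x * \<beta> r y))"
    by (rule xor_value_le_pointwise[of M N "\<lambda>r x y. \<alpha> r x" "\<lambda>r x y. \<beta> r y" G])
       (use assms in \<open>auto simp: local_strategy_def\<close>)
  let ?R = "return borel (0 :: real)"
  have ls: "local_strategy N ?R (\<lambda>_. \<alpha> r) (\<lambda>_. \<beta> r)"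
    using assms r by (auto simp: local_strategy_def prob_space_return)
  have "(\<Sum>x<N. \<Sum>y<N. G x y * (\<alpha> r x * \<beta> r y)) = xor_value N G ?R (\<lambda>_ x y. \<alpha> r x) (\<lambda>_ x y. \<beta> r y)"
    by (simp add: xor_value_def measure_return)
  also have "\<dots> \<le> classical_value N G"
    unfolding classical_value_def
  proof (rule cSup_upper)
    show "bdd_above {xor_value N G M (\<lambda>r x y. \<alpha> r x) (\<lambda>r x y. \<beta> r y) |
            (M :: real measure) \<alpha> \<beta>. local_strategy N M \<alpha> \<beta>}"
    proof (rule bdd_aboveI[of _ "\<Sum>x<N. \<Sum>y<N. \<bar>G x y\<bar>"], clarify)
      fix M :: "real measure" and \<alpha> \<beta>
      assume "local_strategy N M \<alpha> \<beta>"
      then show "xor_value N G M (\<lambda>r x y. \<alpha> r x) (\<lambda>r x y. \<beta> r y) \<le> (\<Sum>x<N. \<Sum>y<N. \<bar>G x y\<bar>)"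
        unfolding local_strategy_def by (intro xor_value_le_sum_abs) blast+
    qed
  qed (rule CollectI, rule exI[of _ ?R], rule exI[of _ "\<lambda>_. \<alpha> r"], rule exI[of _ "\<lambda>_. \<beta> r"],
      rule conjI[OF refl ls])
  finally show ?thesis using le by linarith
qed

lemma xor_value_le_comm_value:
  fixes M :: "'r measure"
  assumes "comm_strategy c N M P \<alpha> \<beta>"
  shows "xor_value N G M (\<lambda>r x y. \<alpha> r x (transcript (P r) x y))
           (\<lambda>r x y. \<beta> r y (transcript (P r) x y)) \<le> comm_value c N G"
proof -
  let ?t = "\<lambda>r. transcript (P r)"
  obtain r where r: "r \<in> space M"
    and le: "xor_value N G M (\<lambda>r x y. \<alpha> r x (?t r x y)) (\<lambda>r x y. \<beta> r y (?t r x y))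
      \<le> (\<Sum>x<N. \<Sum>y<N. G x y * (\<alpha> r x (?t r x y) * \<beta> r y (?t r x y)))"
    by (rule xor_value_le_pointwise[of M N "\<lambda>r x y. \<alpha> r x (?t r x y)"
            "\<lambda>r x y. \<beta> r y (?t r x y)" G])
       (use assms in \<open>auto simp: comm_strategy_def\<close>)
  let ?R = "return borel (0 :: real)"
  have ls: "comm_strategy c N ?R (\<lambda>_. P r) (\<lambda>_. \<alpha> r) (\<lambda>_. \<beta> r)"
    using assms r by (auto simp: comm_strategy_def prob_space_return)
  have "(\<Sum>x<N. \<Sum>y<N. G x y * (\<alpha> r x (?t r x y) * \<beta> r y (?t r x y)))
      = xor_value N G ?R (\<lambda>_ x y. \<alpha> r x (?t r x y)) (\<lambda>_ x y. \<beta> r y (?t r x y))"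
    by (simp add: xor_value_def measure_return)
  also have "\<dots> \<le> comm_value c N G"
    unfolding comm_value_def
  proof (rule cSup_upper)
    show "bdd_above {xor_value N G M (\<lambda>r x y. \<alpha> r x (transcript (P r) x y))
                          (\<lambda>r x y. \<beta> r y (transcript (P r) x y)) |
            (M :: real measure) P \<alpha> \<beta>. comm_strategy c N M P \<alpha> \<beta>}"
    proof (rule bdd_aboveI[of _ "\<Sum>x<N. \<Sum>y<N. \<bar>G x y\<bar>"], clarify)
      fix M :: "real measure" and P \<alpha> \<beta>
      assume "comm_strategy c N M P \<alpha> \<beta>"
      then show "xor_value N G M (\<lambda>r x y. \<alpha> r x (transcript (P r) x y))
          (\<lambda>r x y. \<beta> r y (transcript (P r) x y)) \<le> (\<Sum>x<N. \<Sum>y<N. \<bar>G x y\<bar>)"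
        unfolding comm_strategy_def by (intro xor_value_le_sum_abs) blast+
    qed
  qed (rule CollectI, rule exI[of _ ?R], rule exI[of _ "\<lambda>_. P r"], rule exI[of _ "\<lambda>_. \<alpha> r"],
      rule exI[of _ "\<lambda>_. \<beta> r"], rule conjI[OF refl ls])
  finally show ?thesis using le by linarith
qed

end

theory Submission
  imports Defs
begin

text \<open>The game plays, with probability \<open>\<delta>\<close>, the single question \<open>(0, 0)\<close>, which is won by
  constant answers, and otherwise a uniformly random question of a Hadamard game of size \<open>n\<close>.
  A deterministic protocol with \<open>c\<close> bits cuts the questions into at most \<open>2 ^ c\<close> rectangles, on
  each of which the strategy is a product of signs; by orthogonality of the columns, each
  rectangle contributes at most \<open>n powr (3/2) / n\<^sup>2\<close> to the value of the Hadamard game. So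
  communication cannot extract more than \<open>2 ^ c / sqrt n\<close> from it, which tends to \<open>0\<close>.\<close>

section \<open>Hadamard matrices and their bilinear forms\<close>

text \<open>Hadamard matrices of order \<open>n\<close>. Signs are required at all indices, not only
  below \<open>n\<close>, so that index arithmetic such as \<open>x div 2\<close> needs no range
  conditions.\<close>

definition sign_orthogonal :: "nat \<Rightarrow> (nat \<Rightarrow> nat \<Rightarrow> real) \<Rightarrow> bool" where
  "sign_orthogonal n S \<longleftrightarrow>
     (\<forall>x y. S x y \<in> {-1, 1}) \<and>
     (\<forall>y<n. \<forall>y'<n. (\<Sum>x<n. S x y * S x y') = (if y = y' then real n else 0))"

lemma sum_lessThan_double:
  fixes f :: "nat \<Rightarrow> 'a::comm_monoid_add"
  shows "(\<Sum>x<2 * n. f x) = (\<Sum>x<n. f (2 * x) + f (2 * x + 1))"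
  by (induction n) (simp_all add: add.assoc)

text \<open>Sylvester's doubling construction, normalised so that the entry won by constant answers
  is \<open>(0, 0)\<close>.\<close>

lemma sign_orthogonal_power2_exists: "\<exists>S. sign_orthogonal (2 ^ k) S \<and> S 0 0 = 1"
proof (induction k)
  case 0
  show ?case by (rule exI[of _ "\<lambda>_ _. 1"]) (simp add: sign_orthogonal_def)
next
  case (Suc k)
  then obtain S where S: "sign_orthogonal (2 ^ k) S" and S0: "S 0 0 = 1" by blast
  \<comment> \<open>\<open>s\<close> reads the 2 by 2 Hadamard matrix off the parities, so
    \<open>T\<close> is the Kronecker product of \<open>S\<close> with it: the last binary digit
    indexes the small factor.\<close>
  define s :: "nat \<Rightarrow> nat \<Rightarrow> real" where "s x y = (if odd x \<and> odd y then -1 else 1)" for x y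
  define T where "T x y = S (x div 2) (y div 2) * s x y" for x y
  have signs: "T x y \<in> {-1, 1}" for x y
  proof -
    have "S (x div 2) (y div 2) \<in> {-1, 1}" using S by (simp add: sign_orthogonal_def)
    then show ?thesis by (auto simp: T_def s_def)
  qed
  have orth: "(\<Sum>x<2 ^ Suc k. T x y * T x y') = (if y = y' then real (2 ^ Suc k) else 0)"
    if "y < 2 ^ Suc k" "y' < 2 ^ Suc k" for y y'
  proof -
    have "(\<Sum>x<2 ^ Suc k. T x y * T x y')
        = (\<Sum>x<2 ^ k. S x (y div 2) * S x (y' div 2)) * (1 + s 1 y * s 1 y')"
      unfolding power_Suc sum_lessThan_double sum_distrib_right
      by (intro sum.cong) (auto simp: T_def s_def algebra_simps)
    also have "(\<Sum>x<2 ^ k. S x (y div 2) * S x (y' div 2))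
        = (if y div 2 = y' div 2 then real (2 ^ k) else 0)"
      using S that by (simp add: sign_orthogonal_def less_mult_imp_div_less mult.commute)
    \<comment> \<open>Columns with different halves are killed by the orthogonality of
      \<open>S\<close>. With equal halves, the second factor is 2 for equal parities and 0
      otherwise.\<close>
    also have "\<dots> * (1 + s 1 y * s 1 y') = (if y = y' then real (2 ^ Suc k) else 0)"
    proof (cases "y div 2 = y' div 2")
      case True
      then have "y = y' \<longleftrightarrow> (odd y \<longleftrightarrow> odd y')"
        by (metis bit_eq_rec)
      with True show ?thesis by (auto simp: s_def)
    qed auto
    finally show ?thesis .
  qed
  have "T 0 0 = 1" by (simp add: T_def s_def S0)
  with signs orth show ?case unfolding sign_orthogonal_def by blast
qed

text \<open>Lindsey's lemma: orthogonality of the columns gives |Sv|^2 = n |v|^2 \<le> n^2, and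
  Cauchy-Schwarz against \<open>u\<close> adds a factor sqrt n. Entries of modulus at most 1, rather
  than signs, let zeros encode a restriction to a rectangle.\<close>

lemma sign_orthogonal_bilinear_le:
  assumes S: "sign_orthogonal n S"
    and u: "\<And>x. x < n \<Longrightarrow> \<bar>u x\<bar> \<le> 1" and v: "\<And>y. y < n \<Longrightarrow> \<bar>v y\<bar> \<le> 1"
  shows "\<bar>\<Sum>x<n. \<Sum>y<n. S x y * (u x * v y)\<bar> \<le> real n * sqrt n"
proof -
  have u2: "(u x)\<^sup>2 \<le> 1" if "x < n" for x using u[OF that] by (simp add: abs_square_le_1)
  have v2: "(v y)\<^sup>2 \<le> 1" if "y < n" for y using v[OF that] by (simp add: abs_square_le_1)
  define w where "w x = (\<Sum>y<n. S x y * v y)" for x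
  have "(\<Sum>x<n. (w x)\<^sup>2) = (\<Sum>x<n. \<Sum>y<n. \<Sum>y'<n. (S x y * S x y') * (v y * v y'))"
    unfolding w_def power2_eq_square sum_product by (simp add: mult_ac)
  also have "\<dots> = (\<Sum>y<n. \<Sum>x<n. \<Sum>y'<n. (S x y * S x y') * (v y * v y'))"
    by (rule sum.swap)
  also have "\<dots> = (\<Sum>y<n. \<Sum>y'<n. (\<Sum>x<n. S x y * S x y') * (v y * v y'))"
    unfolding sum_distrib_right by (rule sum.cong, rule refl, rule sum.swap)
  also have "\<dots> = (\<Sum>y<n. \<Sum>y'<n. if y = y' then real n * (v y)\<^sup>2 else 0)"
    using S by (intro sum.cong refl) (auto simp: sign_orthogonal_def power2_eq_square)
  also have "\<dots> = real n * (\<Sum>y<n. (v y)\<^sup>2)"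
    by (simp add: sum_distrib_left)
  also have "\<dots> \<le> real n * (\<Sum>y<n. 1)"
    by (intro mult_left_mono sum_mono v2) auto
  finally have w: "(\<Sum>x<n. (w x)\<^sup>2) \<le> (real n)\<^sup>2" by (simp add: power2_eq_square)
  have "(\<Sum>x<n. \<Sum>y<n. S x y * (u x * v y)) = (\<Sum>x<n. u x * w x)"
    unfolding w_def by (simp add: sum_distrib_left mult_ac)
  also have "\<bar>\<dots>\<bar> \<le> sqrt ((\<Sum>x<n. (u x)\<^sup>2) * (\<Sum>x<n. (w x)\<^sup>2))"
    by (intro real_le_rsqrt) (simp add: Cauchy_Schwarz_ineq_sum)
  also have "\<dots> \<le> sqrt ((\<Sum>x<n. 1) * (real n)\<^sup>2)"
    by (intro real_sqrt_le_mono mult_mono w sum_mono u2) (auto intro: sum_nonneg)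
  finally show ?thesis by (simp add: real_sqrt_mult mult.commute)
qed

section \<open>From rectangles to communication protocols\<close>

text \<open>Each bit splits the sender's side of the rectangle in two, and each half runs a subtree
  with one bit less, so the bound doubles per bit. At a leaf the outputs depend on the own input
  alone and \<open>K\<close> applies. The induction therefore varies the rectangle, the budget and
  the output maps.\<close>

lemma protocol_sum_le:
  fixes H :: "nat \<Rightarrow> nat \<Rightarrow> real"
  assumes K: "\<And>A B a b. A \<subseteq> X \<Longrightarrow> B \<subseteq> Y \<Longrightarrow> (\<And>x. x \<in> A \<Longrightarrow> \<bar>a x\<bar> \<le> 1) \<Longrightarrow>
        (\<And>y. y \<in> B \<Longrightarrow> \<bar>b y\<bar> \<le> 1) \<Longrightarrow> (\<Sum>x\<in>A. \<Sum>y\<in>B. H x y * (a x * b y)) \<le> K"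
    and fin: "finite X" "finite Y"
    and "A \<subseteq> X" "B \<subseteq> Y"
    and "\<And>x y. x \<in> A \<Longrightarrow> y \<in> B \<Longrightarrow> length (transcript P x y) \<le> c"
    and "\<And>x t. x \<in> A \<Longrightarrow> \<bar>\<alpha> x t\<bar> \<le> 1"
    and "\<And>y t. y \<in> B \<Longrightarrow> \<bar>\<beta> y t\<bar> \<le> 1"
  shows "(\<Sum>x\<in>A. \<Sum>y\<in>B. H x y * (\<alpha> x (transcript P x y) * \<beta> y (transcript P x y))) \<le> 2 ^ c * K"
  using assms(4-)
proof (induction P arbitrary: c A B \<alpha> \<beta>)
  case Stop
  \<comment> \<open>Taken from the empty rectangle; it allows \<open>K\<close> to grow to
    \<open>2 ^ c * K\<close> when fewer than \<open>c\<close> bits are sent.\<close>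
  have "0 \<le> K" using K[of "{}" "{}"] by simp
  have "(\<Sum>x\<in>A. \<Sum>y\<in>B. H x y * (\<alpha> x [] * \<beta> y [])) \<le> 1 * K"
    using Stop by (simp add: K)
  also have "\<dots> \<le> 2 ^ c * K" using \<open>0 \<le> K\<close> by (intro mult_right_mono) simp_all
  finally show ?case by simp
next
  case (Alice m k)
  have "0 \<le> K" using K[of "{}" "{}"] by simp
  have fA: "finite A" using Alice.prems(1) fin(1) by (rule finite_subset)
  show ?case
  \<comment> \<open>On an empty rectangle the length hypothesis is vacuous and \<open>c\<close> may
    be 0, but the sum vanishes. Otherwise a bit is sent and \<open>c\<close> is positive.\<close>
  proof (cases "A = {} \<or> B = {}")
    case True
    then show ?thesis using \<open>0 \<le> K\<close> by auto
  next
    case False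
    with Alice.prems(3) obtain d where d: "c = Suc d"
      by (cases c) fastforce+
    define Q where "Q i = {x \<in> A. m x = i}" for i
    have part: "(\<Sum>x\<in>Q i. \<Sum>y\<in>B. H x y * (\<alpha> x (transcript (Alice m k) x y) *
        \<beta> y (transcript (Alice m k) x y))) \<le> 2 ^ d * K" (is "?s i \<le> _") for i
    proof -
      have "?s i = (\<Sum>x\<in>Q i. \<Sum>y\<in>B. H x y * (\<alpha> x (i # transcript (k i) x y) *
          \<beta> y (i # transcript (k i) x y)))"
        by (intro sum.cong) (auto simp: Q_def)
      also have "\<dots> \<le> 2 ^ d * K"
        \<comment> \<open>The subtree sees transcripts without the bit just sent, so the output maps
          put \<open>i\<close> back in front.\<close>
        by (rule Alice.IH[of "k i" "Q i" B d "\<lambda>x t. \<alpha> x (i # t)" "\<lambda>y t. \<beta> y (i # t)"])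
           (use Alice.prems in \<open>auto simp: Q_def d\<close>)
      finally show ?thesis .
    qed
    have A: "A = Q True \<union> Q False" by (auto simp: Q_def)
    have "(\<Sum>x\<in>A. \<Sum>y\<in>B. H x y * (\<alpha> x (transcript (Alice m k) x y) *
        \<beta> y (transcript (Alice m k) x y))) = ?s True + ?s False"
      by (subst A, rule sum.union_disjoint) (use fA in \<open>auto simp: Q_def\<close>)
    with part[of True] part[of False] show ?thesis by (simp add: d)
  qed
next
  case (Bob m k)
  have "0 \<le> K" using K[of "{}" "{}"] by simp
  have fB: "finite B" using Bob.prems(2) fin(2) by (rule finite_subset)
  show ?case
  proof (cases "A = {} \<or> B = {}")
    case True
    then show ?thesis using \<open>0 \<le> K\<close> by auto
  next
    case False
    with Bob.prems(3) obtain d where d: "c = Suc d"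
      by (cases c) fastforce+
    define Q where "Q i = {y \<in> B. m y = i}" for i
    have part: "(\<Sum>x\<in>A. \<Sum>y\<in>Q i. H x y * (\<alpha> x (transcript (Bob m k) x y) *
        \<beta> y (transcript (Bob m k) x y))) \<le> 2 ^ d * K" (is "?s i \<le> _") for i
    proof -
      have "?s i = (\<Sum>x\<in>A. \<Sum>y\<in>Q i. H x y * (\<alpha> x (i # transcript (k i) x y) *
          \<beta> y (i # transcript (k i) x y)))"
        by (intro sum.cong) (auto simp: Q_def)
      also have "\<dots> \<le> 2 ^ d * K"
        by (rule Bob.IH[of "k i" A "Q i" d "\<lambda>x t. \<alpha> x (i # t)" "\<lambda>y t. \<beta> y (i # t)"])
           (use Bob.prems in \<open>auto simp: Q_def d\<close>)
      finally show ?thesis .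
    qed
    have B: "B = Q True \<union> Q False" by (auto simp: Q_def)
    \<comment> \<open>Bob's bit splits the inner sum; an arbitrary \<open>g\<close> lets the
      equation rewrite under the sum over \<open>A\<close>.\<close>
    have split: "(\<Sum>y\<in>B. g y) = (\<Sum>y\<in>Q True. g y) + (\<Sum>y\<in>Q False. g y)" for g :: "nat \<Rightarrow> real"
      by (subst B, rule sum.union_disjoint) (use fB in \<open>auto simp: Q_def\<close>)
    have "(\<Sum>x\<in>A. \<Sum>y\<in>B. H x y * (\<alpha> x (transcript (Bob m k) x y) *
        \<beta> y (transcript (Bob m k) x y))) = ?s True + ?s False"
      unfolding split sum.distrib ..
    with part[of True] part[of False] show ?thesis by (simp add: d)
  qed
qed

lemma sign_orthogonal_protocol_le:
  assumes S: "sign_orthogonal n S"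
    and len: "\<And>x y. x < n \<Longrightarrow> y < n \<Longrightarrow> length (transcript P x y) \<le> c"
    and \<alpha>: "\<And>x t. x < n \<Longrightarrow> \<bar>\<alpha> x t\<bar> \<le> 1"
    and \<beta>: "\<And>y t. y < n \<Longrightarrow> \<bar>\<beta> y t\<bar> \<le> 1"
  shows "(\<Sum>x<n. \<Sum>y<n. S x y * (\<alpha> x (transcript P x y) * \<beta> y (transcript P x y)))
    \<le> 2 ^ c * (real n * sqrt n)"
proof (rule protocol_sum_le[where X = "{..<n}" and Y = "{..<n}"])
  fix A B and a b :: "nat \<Rightarrow> real"
  assume AB: "A \<subseteq> {..<n}" "B \<subseteq> {..<n}"
    and a: "\<And>x. x \<in> A \<Longrightarrow> \<bar>a x\<bar> \<le> 1" and b: "\<And>y. y \<in> B \<Longrightarrow> \<bar>b y\<bar> \<le> 1"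
  \<comment> \<open>Extension by zero turns the sum over a rectangle into a full bilinear
    form.\<close>
  let ?u = "\<lambda>x. if x \<in> A then a x else 0" and ?v = "\<lambda>y. if y \<in> B then b y else 0"
  have "(\<Sum>x\<in>A. \<Sum>y\<in>B. S x y * (a x * b y)) = (\<Sum>x<n. \<Sum>y<n. S x y * (?u x * ?v y))"
    using AB by (intro sum.mono_neutral_cong_left) (auto intro!: sum.mono_neutral_cong_left)
  also have "\<dots> \<le> real n * sqrt n"
    using sign_orthogonal_bilinear_le[OF S, of ?u ?v] a b by (simp add: abs_le_iff)
  finally show "(\<Sum>x\<in>A. \<Sum>y\<in>B. S x y * (a x * b y)) \<le> real n * sqrt n" .
qed (use assms in auto)

section \<open>Deterministic strategies and the two values\<close>

lemma local_strategy_return: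
  assumes "\<And>x. x < N \<Longrightarrow> a x \<in> {-1, 1}" and "\<And>y. y < N \<Longrightarrow> b y \<in> {-1, 1}"
  shows "local_strategy N (return borel (0 :: real)) (\<lambda>_. a) (\<lambda>_. b)"
  using assms by (simp add: local_strategy_def prob_space_return)

lemma sum_le_classical_value:
  assumes "\<And>x. x < N \<Longrightarrow> a x \<in> {-1, 1}" and "\<And>y. y < N \<Longrightarrow> b y \<in> {-1, 1}"
  shows "(\<Sum>x<N. \<Sum>y<N. G x y * (a x * b y)) \<le> classical_value N G"
  using xor_value_le_classical_value[OF local_strategy_return[OF assms], where G = G]
  by (simp add: xor_value_def measure_return)

text \<open>A local strategy is a protocol that stops at once, which fits every budget
  \<open>c\<close>.\<close>

lemma classical_value_le_comm_value: "classical_value N G \<le> comm_value c N G"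
  unfolding classical_value_def
proof (rule cSup_least)
  show "{xor_value N G M (\<lambda>r x y. \<alpha> r x) (\<lambda>r x y. \<beta> r y) |
      (M :: real measure) \<alpha> \<beta>. local_strategy N M \<alpha> \<beta>} \<noteq> {}"
    using local_strategy_return[of N "\<lambda>_. 1" "\<lambda>_. 1"] by auto
next
  fix v
  assume "v \<in> {xor_value N G M (\<lambda>r x y. \<alpha> r x) (\<lambda>r x y. \<beta> r y) |
      (M :: real measure) \<alpha> \<beta>. local_strategy N M \<alpha> \<beta>}"
  then obtain M :: "real measure" and \<alpha> \<beta> where ls: "local_strategy N M \<alpha> \<beta>"
    and v: "v = xor_value N G M (\<lambda>r x y. \<alpha> r x) (\<lambda>r x y. \<beta> r y)" by blast
  have "comm_strategy c N M (\<lambda>_. Stop) (\<lambda>r x _. \<alpha> r x) (\<lambda>r y _. \<beta> r y)"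
    using ls by (auto simp: local_strategy_def comm_strategy_def)
  from xor_value_le_comm_value[OF this] show "v \<le> comm_value c N G" unfolding v .
qed

text \<open>Some value of the shared randomness does at least as well as the average, so a bound for
  deterministic protocols suffices.\<close>

lemma comm_value_le:
  assumes "\<And>P \<alpha> \<beta>. (\<And>x y. x < N \<Longrightarrow> y < N \<Longrightarrow> length (transcript P x y) \<le> c) \<Longrightarrow>
      (\<And>x t. x < N \<Longrightarrow> \<alpha> x t \<in> {-1, 1}) \<Longrightarrow> (\<And>y t. y < N \<Longrightarrow> \<beta> y t \<in> {-1, 1}) \<Longrightarrow>
      (\<Sum>x<N. \<Sum>y<N. G x y * (\<alpha> x (transcript P x y) * \<beta> y (transcript P x y))) \<le> B"
  shows "comm_value c N G \<le> B"
  unfolding comm_value_def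
proof (rule cSup_least)
  have "comm_strategy c N (return borel (0 :: real)) (\<lambda>_. Stop) (\<lambda>_ _ _. 1) (\<lambda>_ _ _. 1)"
    by (simp add: comm_strategy_def prob_space_return)
  then show "{xor_value N G M (\<lambda>r x y. \<alpha> r x (transcript (P r) x y))
      (\<lambda>r x y. \<beta> r y (transcript (P r) x y)) |
      (M :: real measure) P \<alpha> \<beta>. comm_strategy c N M P \<alpha> \<beta>} \<noteq> {}" by blast
next
  fix v
  assume "v \<in> {xor_value N G M (\<lambda>r x y. \<alpha> r x (transcript (P r) x y))
      (\<lambda>r x y. \<beta> r y (transcript (P r) x y)) |
      (M :: real measure) P \<alpha> \<beta>. comm_strategy c N M P \<alpha> \<beta>}"
  then obtain M :: "real measure" and P \<alpha> \<beta> where cs: "comm_strategy c N M P \<alpha> \<beta>"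
    and v: "v = xor_value N G M (\<lambda>r x y. \<alpha> r x (transcript (P r) x y))
      (\<lambda>r x y. \<beta> r y (transcript (P r) x y))" by blast
  obtain r where r: "r \<in> space M" and le: "v \<le> (\<Sum>x<N. \<Sum>y<N.
      G x y * (\<alpha> r x (transcript (P r) x y) * \<beta> r y (transcript (P r) x y)))"
    unfolding v
    by (rule xor_value_le_pointwise[of M N "\<lambda>r x y. \<alpha> r x (transcript (P r) x y)"
          "\<lambda>r x y. \<beta> r y (transcript (P r) x y)" G])
       (use cs in \<open>auto simp: comm_strategy_def\<close>)
  note le
  also have "(\<Sum>x<N. \<Sum>y<N.
      G x y * (\<alpha> r x (transcript (P r) x y) * \<beta> r y (transcript (P r) x y))) \<le> B"
    by (rule assms) (use cs r in \<open>auto simp: comm_strategy_def\<close>)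
  finally show "v \<le> B" .
qed

section \<open>The mixed game and the choice of its size\<close>

definition mixed_game ::
  "real \<Rightarrow> nat \<Rightarrow> (nat \<Rightarrow> nat \<Rightarrow> real) \<Rightarrow> nat \<Rightarrow> nat \<Rightarrow> real" where
  "mixed_game \<delta> n S x y =
     (if x = 0 \<and> y = 0 then \<delta> else 0) + (1 - \<delta>) / (real n)\<^sup>2 * S x y"

text \<open>The two components overlap at (0, 0). Since \<open>S 0 0 = 1\<close>, their signs agree
  there, so the probabilities add without cancellation and \<open>S\<close> serves as the sign
  function of the whole game.\<close>

lemma is_xor_game_mixed_game:
  assumes "0 \<le> \<delta>" and "\<delta> \<le> 1" and "0 < n"
    and S: "\<And>x y. S x y \<in> {-1, 1}" and "S 0 0 = 1"
  shows "is_xor_game n (mixed_game \<delta> n S)"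
proof -
  let ?Q = "{..<n} \<times> {..<n}"
  define \<pi> where "\<pi> = bernoulli_pmf \<delta> \<bind>
    (\<lambda>b. if b then return_pmf (0, 0) else pmf_of_set ?Q)"
  have Q: "finite ?Q" "?Q \<noteq> {}" using \<open>0 < n\<close> by auto
  have "set_pmf (pmf_of_set ?Q) = ?Q" using Q by (rule set_pmf_of_set[rotated])
  then have "set_pmf \<pi> \<subseteq> ?Q"
    unfolding \<pi>_def set_bind_pmf using \<open>0 < n\<close> by (intro UN_least) simp
  moreover have "mixed_game \<delta> n S x y = pmf \<pi> (x, y) * S x y" if "x < n" "y < n" for x y
    using assms Q that
    by (auto simp: \<pi>_def mixed_game_def pmf_bind pmf_of_set power2_eq_square algebra_simps)
  ultimately show ?thesis
    unfolding is_xor_game_def using S by blast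
qed

lemma mixed_game_sum:
  assumes "0 < n"
  shows "(\<Sum>x<n. \<Sum>y<n. mixed_game \<delta> n S x y * h x y) =
    \<delta> * h 0 0 + (1 - \<delta>) / (real n)\<^sup>2 * (\<Sum>x<n. \<Sum>y<n. S x y * h x y)"
proof -
  have "(\<Sum>x<n. \<Sum>y<n. mixed_game \<delta> n S x y * h x y) =
      (\<Sum>x<n. \<Sum>y<n. if x = 0 \<and> y = 0 then \<delta> * h 0 0 else 0) +
      (\<Sum>x<n. \<Sum>y<n. (1 - \<delta>) / (real n)\<^sup>2 * (S x y * h x y))"
    unfolding sum.distrib[symmetric]
    by (intro sum.cong refl) (simp add: mixed_game_def algebra_simps)
  also have "(\<Sum>x<n. \<Sum>y<n. if x = 0 \<and> y = 0 then \<delta> * h 0 0 else 0) =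
      (\<Sum>x<n. if x = 0 then \<delta> * h 0 0 else 0)"
    using assms by (intro sum.cong refl) simp
  also have "\<dots> = \<delta> * h 0 0" using assms by simp
  finally show ?thesis by (simp only: sum_distrib_left)
qed

theorem theorem1p1:
  fixes \<delta> \<epsilon> :: real and c :: nat
  assumes "0 < \<delta>" and "\<delta> < 1" and "\<epsilon> > 0"
  shows "\<exists>(N :: nat) (G :: nat \<Rightarrow> nat \<Rightarrow> real). is_xor_game N G \<and>
           \<delta> - \<epsilon> \<le> classical_value N G \<and> classical_value N G \<le> \<delta> + \<epsilon> \<and>
           \<delta> - \<epsilon> \<le> comm_value c N G \<and> comm_value c N G \<le> \<delta> + \<epsilon>"
proof -
  \<comment> \<open>The target is 2^c / sqrt n < \<epsilon>; taking \<open>n\<close> to be a power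
    of four makes sqrt n exactly \<open>2 ^ m\<close>.\<close>
  obtain m where "(1 / 2) ^ m < \<epsilon> / 2 ^ c"
    using real_arch_pow_inv[of "\<epsilon> / 2 ^ c" "1 / 2"] assms by auto
  then have m: "2 ^ c / 2 ^ m < \<epsilon>" by (simp add: field_simps)
  define n :: nat where "n = 2 ^ (2 * m)"
  have n: "0 < n" by (simp add: n_def)
  have "real n = (2 ^ m)\<^sup>2" by (simp add: n_def power_even_eq)
  then have sqrt_n: "sqrt n = 2 ^ m" by simp
  obtain S where S: "sign_orthogonal n S" and S0: "S 0 0 = 1"
    using sign_orthogonal_power2_exists[of "2 * m"] unfolding n_def by blast
  let ?G = "mixed_game \<delta> n S"
  have game: "is_xor_game n ?G"
    using assms n S S0 by (intro is_xor_game_mixed_game) (auto simp: sign_orthogonal_def)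
  \<comment> \<open>Stated for an arbitrary \<open>t\<close>, as it serves twice: for the value of a
    protocol and for the negated value of constant answers.\<close>
  have bound: "(1 - \<delta>) / (real n)\<^sup>2 * t \<le> \<epsilon>" if "t \<le> 2 ^ c * (real n * sqrt n)" for t
  proof -
    have "(1 - \<delta>) / (real n)\<^sup>2 * t \<le> (1 - \<delta>) / (real n)\<^sup>2 * (2 ^ c * (real n * sqrt n))"
      using assms that by (intro mult_left_mono) simp_all
    also have "\<dots> \<le> 1 / (real n)\<^sup>2 * (2 ^ c * (real n * sqrt n))"
      using assms by (intro mult_right_mono divide_right_mono) simp_all
    also have "\<dots> = 2 ^ c * sqrt n / real n"
      using n by (simp add: power2_eq_square)
    also have "\<dots> = 2 ^ c * sqrt n / (sqrt n * sqrt n)" by simp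
    also have "\<dots> = 2 ^ c / 2 ^ m"
      unfolding sqrt_n by simp
    finally show ?thesis using m by linarith
  qed
  have upper: "comm_value c n ?G \<le> \<delta> + \<epsilon>"
  proof (rule comm_value_le)
    fix P :: protocol and \<alpha> \<beta> :: "nat \<Rightarrow> bool list \<Rightarrow> real"
    assume len: "\<And>x y. x < n \<Longrightarrow> y < n \<Longrightarrow> length (transcript P x y) \<le> c"
      and \<alpha>: "\<And>x t. x < n \<Longrightarrow> \<alpha> x t \<in> {-1, 1}" and \<beta>: "\<And>y t. y < n \<Longrightarrow> \<beta> y t \<in> {-1, 1}"
    let ?t = "transcript P"
    have abs: "\<bar>\<alpha> x t\<bar> \<le> 1" "\<bar>\<beta> x t\<bar> \<le> 1" if "x < n" for x t
      using \<alpha>[OF that, of t] \<beta>[OF that, of t] by auto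
    have "\<alpha> 0 (?t 0 0) * \<beta> 0 (?t 0 0) \<le> 1"
      using \<alpha>[OF n, of "?t 0 0"] \<beta>[OF n, of "?t 0 0"] by auto
    then have "\<delta> * (\<alpha> 0 (?t 0 0) * \<beta> 0 (?t 0 0)) \<le> \<delta>"
      using assms by simp
    moreover have "(\<Sum>x<n. \<Sum>y<n. S x y * (\<alpha> x (?t x y) * \<beta> y (?t x y)))
        \<le> 2 ^ c * (real n * sqrt n)"
      using S len abs by (rule sign_orthogonal_protocol_le)
    ultimately show "(\<Sum>x<n. \<Sum>y<n. ?G x y * (\<alpha> x (?t x y) * \<beta> y (?t x y))) \<le> \<delta> + \<epsilon>"
      unfolding mixed_game_sum[OF n] by (intro add_mono bound)
  qed
  \<comment> \<open>Constant answers 1 win \<delta> on the question (0, 0). Their Hadamard part may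
    be negative, but its modulus is small. The products \<open>1 * 1\<close> keep the shape
    \<open>a x * b y\<close>.\<close>
  have "\<bar>\<Sum>x<n. \<Sum>y<n. S x y * (1 * 1)\<bar> \<le> real n * sqrt n"
    by (rule sign_orthogonal_bilinear_le[OF S]) simp_all
  also have "\<dots> \<le> 2 ^ c * (real n * sqrt n)"
    using mult_right_mono[of 1 "2 ^ c" "real n * sqrt n"] by simp
  finally have "(1 - \<delta>) / (real n)\<^sup>2 * - (\<Sum>x<n. \<Sum>y<n. S x y * (1 * 1)) \<le> \<epsilon>"
    by (intro bound) linarith
  then have "\<delta> - \<epsilon> \<le> (\<Sum>x<n. \<Sum>y<n. ?G x y * (1 * 1))"
    unfolding mixed_game_sum[OF n] by simp
  also have "\<dots> \<le> classical_value n ?G"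
    by (rule sum_le_classical_value) simp_all
  finally have lower: "\<delta> - \<epsilon> \<le> classical_value n ?G" .
  \<comment> \<open>As the classical value is at most the communication value, the lower bound on
    the former and the upper bound on the latter give all four inequalities.\<close>
  show ?thesis
    using game lower upper classical_value_le_comm_value[of n ?G c]
    by (intro exI[of _ n] exI[of _ ?G]) linarith
qed

end
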